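(* Let $d\ge2$ be an integer, $c\in\mathbb{R}$ and $1\le p,q\le\infty$. The estimate $$\Big\|\sup_{t\in[1,2]}\Big|\int_0^1f\big(y_1-tx,\;y_2-t(x^d+c)\big)\,dx\Big|\Big\|_{L^q(\mathbb{R}^2)}\lesssim\|f\|_{L^p(\mathbb{R}^2)}$$ holds only if the following conditions are satisfied: (1) when $c=0$: (C1) $\frac1q\le\frac1p$; (C2) $\frac1q\ge\frac1{2p}$; (C3) $\frac{d+1}p-\frac{d+1}q-1\le0$; (C4) $\frac1q\ge\frac3p-1$; (2) when $c\ne0$: (C1) $\frac1q\le\frac1p$; (C2) $\frac1q\ge\frac1{2p}$; (C5) $\frac1q\ge\frac{d+1}p-1$.
   Context: "The estimate holds" means that there is a constant $C$ (depending only on $p,q,d,c$) such that the inequality with constant $C$ holds for all bounded, compactly supported Borel functions $f$ on $\mathbb{R}^2$. *)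

theory Defs
  imports "HOL-Probability.Essential_Supremum"
begin

text \<open>
  Powers of extended nonnegative reals, with the convention that infinity to any exponent is
  infinity; it is only used with positive exponents.
\<close>

definition ennreal_powr :: "ennreal \<Rightarrow> real \<Rightarrow> ennreal"
  where "ennreal_powr a r = (if a = top then top else ennreal (enn2real a powr r))"

text \<open>
  The \<open>L\<^sup>p\<close> norm, for \<open>1 \<le> p \<le> \<infinity>\<close>, of the (extended) modulus \<open>g\<close> of a function.
\<close>

definition Lp_norm :: "'a measure \<Rightarrow> ereal \<Rightarrow> ('a \<Rightarrow> ennreal) \<Rightarrow> ennreal"
  where "Lp_norm M p g =
    (if p = \<infinity> then esssup M g
     else ennreal_powr (\<integral>\<^sup>+ x. ennreal_powr (g x) (real_of_ereal p) \<partial>M) (1 / real_of_ereal p))"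

definition curve_average ::
  "nat \<Rightarrow> real \<Rightarrow> (real \<times> real \<Rightarrow> complex) \<Rightarrow> real \<Rightarrow> real \<times> real \<Rightarrow> complex"
  where "curve_average d c f t y =
    (LINT x:{0..1}|lborel. f (fst y - t * x, snd y - t * (x ^ d + c)))"

definition maximal_function ::
  "nat \<Rightarrow> real \<Rightarrow> (real \<times> real \<Rightarrow> complex) \<Rightarrow> real \<times> real \<Rightarrow> ennreal"
  where "maximal_function d c f y = (SUP t\<in>{1..2}. ennreal (norm (curve_average d c f t y)))"

text \<open>
  The norms are taken with respect to \<open>lebesgue\<close> rather than \<open>lborel\<close>: the maximal function of a
  Borel function is a supremum over uncountably many \<open>t\<close>, so it is Lebesgue measurable (by measurable
  projection) but in general not Borel, and \<open>esssup\<close> is \<open>top\<close> on functions that are not measurable.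
\<close>

definition estimate_holds :: "nat \<Rightarrow> real \<Rightarrow> ereal \<Rightarrow> ereal \<Rightarrow> bool"
  where "estimate_holds d c p q \<longleftrightarrow>
    (\<exists>C::real. \<forall>f :: real \<times> real \<Rightarrow> complex.
       f \<in> borel_measurable borel \<and> bounded (range f) \<and> compact (closure {y. f y \<noteq> 0}) \<longrightarrow>
       Lp_norm lebesgue q (maximal_function d c f)
         \<le> ennreal C * Lp_norm lebesgue p (\<lambda>y. ennreal (norm (f y))))"

end

theory Submission
  imports Defs
begin

text \<open>
  Tested on the indicator function of a set \<open>F\<close> all of whose averages over a set \<open>E\<close> reach \<open>x\<^sup>k\<close> for
  a suitable \<open>t\<close>, where \<open>\<bar>E\<bar> \<sim> x\<^sup>m\<close> and \<open>\<bar>F\<bar> \<sim> x\<^sup>n\<close>, the estimate forces \<open>n / p \<le> k + m / q\<close> as \<open>x \<rightarrow> 0\<close>.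
  The conditions come from the following pairs. C1: two large squares of side \<open>1 / x\<close>. C2: a small
  square and a neighbourhood of the reflected curve. C3: two \<open>x\<close> by \<open>x\<^sup>d\<close> boxes at the origin, where
  the curve is flat. C4: an \<open>x\<close> by \<open>x\<^sup>2\<close> rectangle tangent to the curve, and the \<open>x\<close>-wide set of points
  whose dilated curve is tangent to it. C5: an \<open>x\<close> by \<open>x\<^sup>d\<close> box, which for \<open>c \<noteq> 0\<close> the flat point
  \<open>(0, t c)\<close> of the dilated curves carries along a segment of unit length.
\<close>

section \<open>Norm bounds\<close>

lemma ennreal_powr_mono: "0 \<le> r \<Longrightarrow> a \<le> b \<Longrightarrow> ennreal_powr a r \<le> ennreal_powr b r"
  by (auto simp: ennreal_powr_def top_unique less_top intro!: ennreal_leI powr_mono2 enn2real_mono)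

lemma ennreal_powr_ennreal: "0 \<le> x \<Longrightarrow> ennreal_powr (ennreal x) r = ennreal (x powr r)"
  by (simp add: ennreal_powr_def)

text \<open>The exponents 1/p and 1/q enter as the reals \<open>real_of_ereal (1 / p)\<close>, with
  value 0 at infinity. As \<open>m powr 0\<close> is 1 for positive \<open>m\<close>, bounds of the
  form \<open>m powr real_of_ereal (1 / p)\<close> cover the infinite case as well.\<close>

lemma ereal_ge_1_cases:
  fixes p :: ereal
  assumes "1 \<le> p"
  obtains "p = \<infinity>" "real_of_ereal (1 / p) = 0"
    | r where "p = ereal r" "1 \<le> r" "real_of_ereal (1 / p) = 1 / r"
  using assms by (cases p) (auto simp: one_ereal_def)

lemma ereal_divide_eq_recip:
  fixes p :: ereal
  assumes "1 \<le> p"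
  shows "ereal s / p = ereal (s * real_of_ereal (1 / p))"
  using assms by (cases rule: ereal_ge_1_cases) auto

text \<open>Chebyshev's inequality for an arbitrary \<open>g\<close>, so that it applies to the
  maximal function without a proof of measurability: the integral is monotone on all functions, and
  \<open>esssup\<close> is \<open>top\<close> on non-measurable ones.\<close>

lemma Lp_norm_ge:
  assumes "1 \<le> q" "E \<in> sets M" "0 < e" "ennreal e \<le> emeasure M E" "0 \<le> l"
    and g: "\<And>y. y \<in> E \<Longrightarrow> ennreal l \<le> g y"
  shows "ennreal (l * e powr real_of_ereal (1 / q)) \<le> Lp_norm M q g"
  using \<open>1 \<le> q\<close>
proof (cases rule: ereal_ge_1_cases)
  case 1
  have "ennreal l \<le> esssup M g"
  proof (cases "g \<in> borel_measurable M")
    case True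
    show ?thesis
    proof (rule ccontr)
      assume "\<not> ennreal l \<le> esssup M g"
      moreover have "AE y in M. g y \<le> esssup M g"
        by (rule esssup_AE)
      ultimately have "AE y in M. y \<notin> E"
        by (auto elim!: eventually_mono dest: g)
      then have "emeasure M E = 0"
        using assms(2) by (subst (asm) AE_iff_measurable[of E]) (auto dest: sets.sets_into_space)
      then show False
        using assms(3,4) by simp
    qed
  qed (simp add: esssup_non_measurable)
  then show ?thesis
    using 1 assms by (simp add: Lp_norm_def)
next
  case (2 r)
  have "ennreal (l powr r * e) \<le> ennreal (l powr r) * emeasure M E"
    using assms by (simp add: ennreal_mult mult_left_mono)
  also have "\<dots> = (\<integral>\<^sup>+ y. ennreal (l powr r) * indicator E y \<partial>M)"
    using \<open>E \<in> sets M\<close> by (rule nn_integral_cmult_indicator[symmetric])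
  also have "\<dots> \<le> (\<integral>\<^sup>+ y. ennreal_powr (g y) r \<partial>M)"
    using 2 assms ennreal_powr_mono[OF _ g, of r]
    by (intro nn_integral_mono) (auto simp: indicator_def ennreal_powr_ennreal)
  finally have "ennreal_powr (ennreal (l powr r * e)) (1 / r) \<le> Lp_norm M q g"
    using 2 by (simp add: Lp_norm_def ennreal_powr_mono)
  moreover have "(l powr r * e) powr (1 / r) = l * e powr (1 / r)"
    using 2 assms by (cases "l = 0") (auto simp: powr_mult powr_powr)
  ultimately show ?thesis
    using 2 assms by (simp add: ennreal_powr_ennreal)
qed

lemma Lp_norm_indicator_le:
  fixes F :: "'a set"
  assumes "1 \<le> p" "F \<in> sets M" "0 < m" "emeasure M F \<le> ennreal m"
  shows "Lp_norm M p (\<lambda>y. ennreal (norm (complex_of_real (indicator F y))))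
    \<le> ennreal (m powr real_of_ereal (1 / p))"
  using \<open>1 \<le> p\<close>
proof (cases rule: ereal_ge_1_cases)
  case 1
  have "esssup M (\<lambda>y. ennreal (norm (complex_of_real (indicator F y)))) \<le> 1"
    using assms by (intro esssup_I) (auto simp: indicator_def)
  then show ?thesis
    using 1 assms by (simp add: Lp_norm_def)
next
  case (2 r)
  have "(\<integral>\<^sup>+ y. ennreal_powr (ennreal (norm (complex_of_real (indicator F y)))) r \<partial>M)
      = (\<integral>\<^sup>+ y. indicator F y \<partial>M)"
    using 2 by (intro nn_integral_cong) (auto simp: indicator_def ennreal_powr_def)
  also have "\<dots> \<le> ennreal m"
    using assms by simp
  finally show ?thesis
    using 2 assms ennreal_powr_mono[of "1 / r" _ "ennreal m"]
    by (simp add: Lp_norm_def ennreal_powr_ennreal)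
qed


section \<open>Testing the estimate on indicator functions\<close>

text \<open>The average of an indicator function is the length of the set of parameters whose curve
  point lies in \<open>F\<close>, and this set contains \<open>{a..b}\<close>.\<close>

lemma maximal_function_indicator_ge:
  fixes F :: "(real \<times> real) set"
  assumes F: "F \<in> sets borel" and t: "t \<in> {1..2}" and ab: "0 \<le> a" "a \<le> b" "b \<le> 1"
    and in_F: "\<And>x. x \<in> {a..b} \<Longrightarrow> (fst y - t * x, snd y - t * (x ^ d + c)) \<in> F"
  shows "ennreal (b - a) \<le> maximal_function d c (\<lambda>y. complex_of_real (indicator F y)) y"
proof -
  define G where "G = {x. (fst y - t * x, snd y - t * (x ^ d + c)) \<in> F}"
  have G: "G \<in> sets borel"
  proof -
    have "(\<lambda>x. (fst y - t * x, snd y - t * (x ^ d + c))) \<in> borel_measurable borel"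
      by (intro borel_measurable_continuous_onI continuous_intros)
    from measurable_sets[OF this F] show ?thesis
      by (simp add: G_def vimage_def)
  qed
  have fin: "emeasure lborel ({0..1} \<inter> G) < \<infinity>"
    by (rule le_less_trans[OF emeasure_mono[of _ "{0..1}"]]) auto
  have "b - a = measure lborel {a..b}"
    using ab by simp
  also have "\<dots> \<le> measure lborel ({0..1} \<inter> G)"
    using ab in_F G fin by (intro measure_mono_fmeasurable) (auto simp: G_def fmeasurable_def)
  also have "\<dots> = norm (curve_average d c (\<lambda>y. complex_of_real (indicator F y)) t y)"
  proof -
    have "curve_average d c (\<lambda>y. complex_of_real (indicator F y)) t y
        = (LINT x|lborel. complex_of_real (indicator ({0..1} \<inter> G) x))"
      unfolding curve_average_def set_lebesgue_integral_def
      by (intro Bochner_Integration.integral_cong) (auto simp: G_def indicator_def)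
    also have "\<dots> = complex_of_real (measure lborel ({0..1} \<inter> G))"
      by (subst integral_complex_of_real) simp
    finally show ?thesis
      by simp
  qed
  finally have "ennreal (b - a)
      \<le> ennreal (norm (curve_average d c (\<lambda>y. complex_of_real (indicator F y)) t y))"
    by (rule ennreal_leI)
  then show ?thesis
    unfolding maximal_function_def using t by (rule SUP_upper2[rotated])
qed

lemma estimate_holds_indicator:
  assumes "estimate_holds d c p q" "1 \<le> p" "1 \<le> q"
  obtains K where "0 < K"
    "\<And>E F e m a b. \<lbrakk>E \<in> sets borel; compact F; 0 < e; ennreal e \<le> emeasure lborel E; 0 < m;
        emeasure lborel F \<le> ennreal m; 0 \<le> a; a \<le> b; b \<le> 1;
        \<And>y. y \<in> E \<Longrightarrow>
          \<exists>t\<in>{1..2}. \<forall>x\<in>{a..b}. (fst y - t * x, snd y - t * (x ^ d + c)) \<in> F\<rbrakk>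
      \<Longrightarrow> (b - a) * e powr real_of_ereal (1 / q) \<le> K * m powr real_of_ereal (1 / p)"
proof -
  obtain C where C: "Lp_norm lebesgue q (maximal_function d c f)
       \<le> ennreal C * Lp_norm lebesgue p (\<lambda>y. ennreal (norm (f y)))"
    if "f \<in> borel_measurable borel" "bounded (range f)" "compact (closure {y. f y \<noteq> 0})" for f
    using assms(1) unfolding estimate_holds_def by blast
  show thesis
  \<comment> \<open>\<open>C\<close> may be negative, and then \<open>ennreal C\<close> is 0; the
    maximum with 1 is positive, so the product on the right can be read as a real number.\<close>
  proof (rule that[of "max C 1"])
    fix E F :: "(real \<times> real) set" and e m a b :: real
    assume E: "E \<in> sets borel" "0 < e" "ennreal e \<le> emeasure lborel E"
      and F: "compact F" "0 < m" "emeasure lborel F \<le> ennreal m"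
      and ab: "0 \<le> a" "a \<le> b" "b \<le> 1"
      and EF: "\<And>y. y \<in> E \<Longrightarrow>
          \<exists>t\<in>{1..2}. \<forall>x\<in>{a..b}. (fst y - t * x, snd y - t * (x ^ d + c)) \<in> F"
    let ?f = "\<lambda>y. complex_of_real (indicator F y)"
    have F_borel: "F \<in> sets borel"
      using F(1) by (simp add: borel_compact)
    have "{y. ?f y \<noteq> 0} = F"
      by (auto simp: indicator_def)
    then have supp: "compact (closure {y. ?f y \<noteq> 0})"
      using F(1) by (simp add: compact_imp_closed)
    have bdd: "bounded (range ?f)"
      by (intro boundedI[of _ 1]) (auto simp: indicator_def)
    have meas: "?f \<in> borel_measurable borel"
      using F_borel by measurable
    have max_ge: "ennreal (b - a) \<le> maximal_function d c ?f y" if "y \<in> E" for y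
      using EF[OF that] maximal_function_indicator_ge[OF F_borel _ ab] by blast
    have "ennreal ((b - a) * e powr real_of_ereal (1 / q))
        \<le> Lp_norm lebesgue q (maximal_function d c ?f)"
      using assms E ab by (intro Lp_norm_ge[OF _ _ _ _ _ max_ge]) auto
    also have "\<dots> \<le> ennreal C * Lp_norm lebesgue p (\<lambda>y. ennreal (norm (?f y)))"
      by (rule C[OF meas bdd supp])
    also have "\<dots> \<le> ennreal (max C 1) * ennreal (m powr real_of_ereal (1 / p))"
      using assms F F_borel by (intro mult_mono Lp_norm_indicator_le) (auto intro: ennreal_leI)
    finally show "(b - a) * e powr real_of_ereal (1 / q) \<le> max C 1 * m powr real_of_ereal (1 / p)"
      by (simp flip: ennreal_mult)
  qed auto
qed

text \<open>If r > s, dividing by x^s gives 1 <= K x^(r - s), whose right side tends to 0 with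
  x.\<close>

lemma powr_scaling_exponent_le:
  fixes K :: real
  assumes "0 < \<delta>" and le: "\<And>x. 0 < x \<Longrightarrow> x < \<delta> \<Longrightarrow> x powr s \<le> K * x powr r"
  shows "r \<le> s"
proof (rule ccontr)
  assume "\<not> r \<le> s"
  then have "((\<lambda>x::real. K * x powr (r - s)) \<longlongrightarrow> K * 0 powr (r - s)) (at_right 0)"
    by (intro tendsto_intros) (auto simp: eventually_at_filter)
  then have "eventually (\<lambda>x. K * x powr (r - s) < 1) (at_right 0)"
    using \<open>\<not> r \<le> s\<close> by (auto dest: order_tendstoD(2)[where a = 1])
  moreover have "eventually (\<lambda>x. x \<in> {0<..<\<delta>}) (at_right (0::real))"
    using assms(1) by (rule eventually_at_right_real)
  ultimately have "eventually (\<lambda>x::real. False) (at_right 0)"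
  proof eventually_elim
    case (elim x)
    then have "1 \<le> K * x powr (r - s)"
      using le[of x] by (simp add: powr_diff field_simps)
    with elim show ?case
      by simp
  qed
  then show False
    by simp
qed

text \<open>Inserting the sizes gives x^(k + m/q) <= K' x^(n/p), where K' absorbs \<open>A\<close>
  and \<open>B\<close> and does not depend on x; letting x tend to 0 compares the exponents.\<close>

lemma estimate_holds_scaling:
  fixes k m n A B \<delta> :: real and E F :: "real \<Rightarrow> (real \<times> real) set" and l r :: "real \<Rightarrow> real"
  assumes est: "estimate_holds d c p q" "1 \<le> p" "1 \<le> q"
    and pos: "0 < \<delta>" "0 < A" "0 < B"
    and EF: "\<And>x. 0 < x \<Longrightarrow> x < \<delta> \<Longrightarrow> E x \<in> sets borel \<and> compact (F x) \<and>
        ennreal (A * x powr m) \<le> emeasure lborel (E x) \<and>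
        emeasure lborel (F x) \<le> ennreal (B * x powr n)"
    and lr: "\<And>x. 0 < x \<Longrightarrow> x < \<delta> \<Longrightarrow> 0 \<le> l x \<and> r x \<le> 1 \<and> r x - l x = x powr k"
    and hit: "\<And>x y. 0 < x \<Longrightarrow> x < \<delta> \<Longrightarrow> y \<in> E x \<Longrightarrow>
        \<exists>t\<in>{1..2}. \<forall>v\<in>{l x..r x}. (fst y - t * v, snd y - t * (v ^ d + c)) \<in> F x"
  shows "n * real_of_ereal (1 / p) \<le> k + m * real_of_ereal (1 / q)"
proof -
  define a b where "a = real_of_ereal (1 / p)" and "b = real_of_ereal (1 / q)"
  obtain K where K: "0 < K"
    "\<And>E F e m s t. \<lbrakk>E \<in> sets borel; compact F; 0 < e; ennreal e \<le> emeasure lborel E; 0 < m;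
        emeasure lborel F \<le> ennreal m; 0 \<le> s; s \<le> t; t \<le> 1;
        \<And>y. y \<in> E \<Longrightarrow>
          \<exists>r\<in>{1..2}. \<forall>x\<in>{s..t}. (fst y - r * x, snd y - r * (x ^ d + c)) \<in> F\<rbrakk>
      \<Longrightarrow> (t - s) * e powr b \<le> K * m powr a"
    using estimate_holds_indicator[OF est] unfolding a_def b_def by metis
  have "n * a \<le> k + m * b"
  proof (rule powr_scaling_exponent_le[OF pos(1)])
    fix x :: real
    assume x: "0 < x" "x < \<delta>"
    have "l x \<le> r x"
      using lr[OF x] powr_ge_zero[of x k] by linarith
    then have "(r x - l x) * (A * x powr m) powr b \<le> K * (B * x powr n) powr a"
      using EF[OF x] lr[OF x] hit[OF x] x pos by (intro K(2)[of "E x" "F x"]) auto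
    then show "x powr (k + m * b) \<le> (K * B powr a / A powr b) * x powr (n * a)"
      using x pos lr[OF x] by (simp add: powr_mult powr_powr powr_add field_simps)
  qed
  then show ?thesis
    by (simp add: a_def b_def)
qed


section \<open>Strips around graphs\<close>

text \<open>One shape for all test sets: boxes (constant \<open>g\<close>), parallelograms (linear
  \<open>g\<close>) and a neighbourhood of the reflected curve.\<close>

definition strip :: "real \<Rightarrow> real \<Rightarrow> (real \<Rightarrow> real) \<Rightarrow> real \<Rightarrow> (real \<times> real) set"
  where "strip l u g w = {y. l \<le> fst y \<and> fst y \<le> u \<and> \<bar>snd y - g (fst y)\<bar> \<le> w}"

text \<open>The shear (x, v) -> (x, g x + v) maps a rectangle onto the strip.\<close>

lemma compact_strip:
  assumes "continuous_on UNIV g"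
  shows "compact (strip l u g w)"
proof -
  have "strip l u g w = (\<lambda>(x, v). (x, g x + v)) ` ({l..u} \<times> {-w..w})"
  proof (intro equalityI subsetI)
    fix y assume "y \<in> strip l u g w"
    then show "y \<in> (\<lambda>(x, v). (x, g x + v)) ` ({l..u} \<times> {-w..w})"
      by (intro image_eqI[of _ _ "(fst y, snd y - g (fst y))"]) (auto simp: strip_def)
  qed (auto simp: strip_def)
  moreover have "continuous_on ({l..u} \<times> {-w..w}) (\<lambda>(x, v). (x, g x + v))"
    unfolding case_prod_unfold
    by (intro continuous_intros continuous_on_compose2[OF assms]) auto
  ultimately show ?thesis
    by (simp add: compact_continuous_image compact_Times)
qed

lemma strip_borel: "continuous_on UNIV g \<Longrightarrow> strip l u g w \<in> sets borel"
  by (simp add: borel_compact compact_strip)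

text \<open>By Fubini: each vertical slice over \<open>{l..u}\<close> is an interval of length
  2w.\<close>

lemma emeasure_strip:
  assumes g: "continuous_on UNIV g" and "l \<le> u" "0 \<le> w"
  shows "emeasure lborel (strip l u g w) = ennreal (2 * w * (u - l))"
proof -
  have "emeasure lborel (strip l u g w)
      = (\<integral>\<^sup>+ x. emeasure lborel (Pair x -` strip l u g w) \<partial>lborel)"
    using strip_borel[OF g, of l u w]
    by (subst lborel_prod[symmetric], subst lborel.emeasure_pair_measure_alt)
      (simp_all only: lborel_prod sets_lborel)
  also have "\<dots> = (\<integral>\<^sup>+ x. ennreal (2 * w) * indicator {l..u} x \<partial>lborel)"
  proof (intro nn_integral_cong)
    fix x
    have "Pair x -` strip l u g w = (if x \<in> {l..u} then {g x - w..g x + w} else {})"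
      by (auto simp: strip_def)
    then show "emeasure lborel (Pair x -` strip l u g w) = ennreal (2 * w) * indicator {l..u} x"
      using assms by simp
  qed
  also have "\<dots> = ennreal (2 * w * (u - l))"
    using assms by (simp add: nn_integral_cmult ennreal_mult)
  finally show ?thesis .
qed

text \<open>With strips as test sets (unprimed data for E, primed for F) only real inequalities
  remain. In the applications, cases 7 and 8 are the two area bounds and case 10 is
  \<open>hit\<close>.\<close>

lemma estimate_holds_strips:
  fixes k m n A B \<delta> :: real and l u w l' u' w' a b :: "real \<Rightarrow> real"
  assumes est: "estimate_holds d c p q" "1 \<le> p" "1 \<le> q"
    and pos: "0 < \<delta>" "0 < A" "0 < B"
    and cont: "continuous_on UNIV g" "continuous_on UNIV g'"
    and widths: "\<And>x. 0 < x \<Longrightarrow> x < \<delta> \<Longrightarrow> l x \<le> u x \<and> 0 \<le> w x \<and> l' x \<le> u' x \<and> 0 \<le> w' x"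
    and area: "\<And>x. 0 < x \<Longrightarrow> x < \<delta> \<Longrightarrow> A * x powr m \<le> 2 * w x * (u x - l x)"
    and area': "\<And>x. 0 < x \<Longrightarrow> x < \<delta> \<Longrightarrow> 2 * w' x * (u' x - l' x) \<le> B * x powr n"
    and ab: "\<And>x. 0 < x \<Longrightarrow> x < \<delta> \<Longrightarrow> 0 \<le> a x \<and> b x \<le> 1 \<and> b x - a x = x powr k"
    and hit: "\<And>x y1 y2. 0 < x \<Longrightarrow> x < \<delta> \<Longrightarrow> l x \<le> y1 \<Longrightarrow> y1 \<le> u x \<Longrightarrow> \<bar>y2 - g y1\<bar> \<le> w x \<Longrightarrow>
        \<exists>t\<in>{1..2}. \<forall>v\<in>{a x..b x}. l' x \<le> y1 - t * v \<and> y1 - t * v \<le> u' x \<and>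
          \<bar>y2 - t * (v ^ d + c) - g' (y1 - t * v)\<bar> \<le> w' x"
  shows "n * real_of_ereal (1 / p) \<le> k + m * real_of_ereal (1 / q)"
proof (rule estimate_holds_scaling[OF est pos, where E = "\<lambda>x. strip (l x) (u x) g (w x)"
        and F = "\<lambda>x. strip (l' x) (u' x) g' (w' x)" and l = a and r = b], goal_cases)
  case (1 x)
  then show ?case
    using widths[OF 1] area[OF 1] area'[OF 1] cont
    by (simp add: strip_borel compact_strip emeasure_strip ennreal_leI)
next
  case (2 x)
  then show ?case
    by (rule ab)
next
  case (3 x y)
  then show ?case
    using hit[of x "fst y" "snd y"] by (simp add: strip_def)
qed


section \<open>The necessary conditions\<close>

text \<open>On squares much larger than the curve, averaging at t = 1 reproduces the value 1, and
  both areas grow like x^(-2).\<close>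

lemma necessary_C1:
  assumes est: "estimate_holds d c p q" "1 \<le> p" "1 \<le> q"
  shows "real_of_ereal (1 / q) \<le> real_of_ereal (1 / p)"
proof -
  \<comment> \<open>For t = 1 both coordinates of the curve are at most \<open>K\<close> in modulus,
    so enlarging the square by \<open>K\<close> on each side catches every translate.\<close>
  define K where "K = 1 + \<bar>c\<bar>"
  have "0 < K"
    by (simp add: K_def)
  have "- 2 * real_of_ereal (1 / p) \<le> 0 + - 2 * real_of_ereal (1 / q)"
  proof (rule estimate_holds_strips[OF est, where \<delta> = 1 and A = 4 and B = "4 * (1 + K)\<^sup>2"
        and l = "\<lambda>x. - (1 / x)" and u = "\<lambda>x. 1 / x" and g = "\<lambda>_. 0" and w = "\<lambda>x. 1 / x"
        and l' = "\<lambda>x. - (1 / x + K)" and u' = "\<lambda>x. 1 / x + K" and g' = "\<lambda>_. 0"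
        and w' = "\<lambda>x. 1 / x + K" and a = "\<lambda>_. 0" and b = "\<lambda>_. 1"], goal_cases)
    case (7 x)
    then show ?case
      by (simp add: powr_minus powr_numeral power2_eq_square field_simps)
  next
    case (8 x)
    have "1 / x + K \<le> (1 + K) / x"
      using 8 mult_left_le[of x K] \<open>0 < K\<close> by (simp add: field_simps)
    then have "4 * (1 / x + K)\<^sup>2 \<le> 4 * ((1 + K) / x)\<^sup>2"
      using 8 by (intro mult_left_mono power_mono) (auto simp: K_def)
    moreover have "2 * (1 / x + K) * (1 / x + K - - (1 / x + K)) = 4 * (1 / x + K)\<^sup>2"
      by (simp add: power2_eq_square algebra_simps)
    moreover have "4 * ((1 + K) / x)\<^sup>2 = 4 * (1 + K)\<^sup>2 * x powr - 2"
      using 8 by (simp add: powr_minus powr_numeral divide_inverse power_mult_distrib power_inverse)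
    ultimately show ?case
      by (simp only:)
  next
    case (10 x y1 y2)
    have "\<bar>y2 - (v ^ d + c)\<bar> \<le> 1 / x + K" if "0 \<le> v" "v \<le> 1" for v
    proof -
      have "0 \<le> v ^ d" "v ^ d \<le> 1"
        using that by (auto intro: power_le_one)
      then show ?thesis
        using 10 by (simp add: K_def)
    qed
    then show ?case
      using 10 by (intro bexI[of _ 1]) (auto simp: K_def)
  qed (auto simp: K_def)
  then show ?thesis
    by simp
qed

text \<open>For y near the origin the points y - (v, v^d + c) follow the reflected curve, the graph
  of \<open>g'\<close>. Hence t = 1 and the whole parameter interval serve, and k = 0.\<close>

lemma necessary_C2:
  assumes est: "estimate_holds d c p q" "1 \<le> p" "1 \<le> q"
  shows "real_of_ereal (1 / p) / 2 \<le> real_of_ereal (1 / q)"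
proof -
  have "1 * real_of_ereal (1 / p) \<le> 0 + 2 * real_of_ereal (1 / q)"
  proof (rule estimate_holds_strips[OF est, where \<delta> = 1 and A = 2 and B = "4 * (real d + 1)"
        and l = "\<lambda>_. 0" and u = "\<lambda>x. x" and g = "\<lambda>_. 0" and w = "\<lambda>x. x"
        and l' = "\<lambda>_. - 1" and u' = "\<lambda>_. 1" and g' = "\<lambda>z. - ((- z) ^ d) - c"
        and w' = "\<lambda>x. (real d + 1) * x" and a = "\<lambda>_. 0" and b = "\<lambda>_. 1"], goal_cases)
    case (10 x y1 y2)
    have "\<bar>y2 - (v ^ d + c) - (- ((- (y1 - v)) ^ d) - c)\<bar> \<le> (real d + 1) * x"
      if "0 \<le> v" "v \<le> 1" for v
    proof -
      \<comment> \<open>As 0 <= y1 <= x < 1, \<open>v - y1\<close> stays in [-1, 1], where the power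
        has Lipschitz constant d. The bound on \<open>y2\<close> contributes the remaining 1 in
        \<open>real d + 1\<close>.\<close>
      have "\<bar>(v - y1) ^ d - v ^ d\<bar> \<le> real d * \<bar>(v - y1) - v\<bar>"
        using norm_power_diff[of "v - y1" v d] that 10 by simp
      also have "\<dots> \<le> real d * x"
        using 10 by (intro mult_left_mono) auto
      finally show ?thesis
        using 10 by (simp add: algebra_simps)
    qed
    then show ?case
      using 10 by (intro bexI[of _ 1]) auto
  qed (auto simp: powr_numeral power2_eq_square intro!: continuous_intros)
  then show ?thesis
    by simp
qed

text \<open>The arc with parameters in [0, x] stays in the box [0, x] by [0, x^d], so doubling the
  box E catches its translates at t = 1; the length x of the arc gives k = 1.\<close>

lemma necessary_C3:
  assumes est: "estimate_holds d 0 p q" "1 \<le> p" "1 \<le> q"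
  shows "(real d + 1) * real_of_ereal (1 / p) - (real d + 1) * real_of_ereal (1 / q) - 1 \<le> 0"
proof -
  have "(real d + 1) * real_of_ereal (1 / p) \<le> 1 + (real d + 1) * real_of_ereal (1 / q)"
  proof (rule estimate_holds_strips[OF est, where \<delta> = 1 and A = 4 and B = 16
        and l = "\<lambda>x. - x" and u = "\<lambda>x. x" and g = "\<lambda>_. 0" and w = "\<lambda>x. x ^ d"
        and l' = "\<lambda>x. - 2 * x" and u' = "\<lambda>x. 2 * x" and g' = "\<lambda>_. 0"
        and w' = "\<lambda>x. 2 * x ^ d" and a = "\<lambda>_. 0" and b = "\<lambda>x. x"], goal_cases)
    case (10 x y1 y2)
    have "\<bar>y2 - v ^ d\<bar> \<le> 2 * x ^ d" if "0 \<le> v" "v \<le> x" for v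
    proof -
      have "0 \<le> v ^ d" "v ^ d \<le> x ^ d"
        using that by (auto intro: power_mono)
      then show ?thesis
        using 10 by simp
    qed
    then show ?case
      using 10 by (intro bexI[of _ 1]) auto
  qed (auto simp: powr_add powr_realpow)
  then show ?thesis
    by simp
qed

text \<open>Bounds the distance of the curve from its tangent at (1, 1). Each induction step adds an
  error (1 - v)(1 - v^n) <= n (1 - v)^2, and n^2 + n <= (n + 1)^2.\<close>

lemma one_minus_power_second_order:
  fixes v :: real
  assumes "0 \<le> v" "v \<le> 1"
  shows "\<bar>1 - v ^ n - real n * (1 - v)\<bar> \<le> (real n)\<^sup>2 * (1 - v)\<^sup>2"
proof (induction n)
  case (Suc n)
  have "1 - v ^ n \<le> real n * (1 - v)" "0 \<le> 1 - v ^ n"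
    using norm_power_diff[of 1 v n] assms by (auto simp: power_le_one)
  then have "(1 - v) * (1 - v ^ n) \<le> (1 - v) * (real n * (1 - v))" "0 \<le> (1 - v) * (1 - v ^ n)"
    using assms by (auto intro!: mult_left_mono)
  moreover have "1 - v ^ Suc n - real (Suc n) * (1 - v)
      = (1 - v ^ n - real n * (1 - v)) - (1 - v) * (1 - v ^ n)"
    by (simp add: algebra_simps)
  ultimately have "\<bar>1 - v ^ Suc n - real (Suc n) * (1 - v)\<bar>
      \<le> (real n)\<^sup>2 * (1 - v)\<^sup>2 + (1 - v) * (real n * (1 - v))"
    using Suc.IH by linarith
  also have "\<dots> = ((real n)\<^sup>2 + real n) * (1 - v)\<^sup>2"
    by (simp add: algebra_simps power2_eq_square)
  also have "\<dots> \<le> (real (Suc n))\<^sup>2 * (1 - v)\<^sup>2"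
    by (intro mult_right_mono zero_le_power2) (simp add: algebra_simps power2_eq_square)
  finally show ?case .
qed simp

text \<open>
  A Knapp example at the endpoint \<open>(1, 1)\<close> of the curve: the dilates of the curve share the tangent
  direction \<open>(1, d)\<close> there, and since \<open>d \<noteq> 1\<close> this direction is transversal to the ray \<open>t (1, 1)\<close>.
\<close>

lemma necessary_C4:
  assumes est: "estimate_holds d 0 p q" "1 \<le> p" "1 \<le> q" and d: "d \<ge> 2"
  shows "3 * real_of_ereal (1 / p) - 1 \<le> real_of_ereal (1 / q)"
proof -
  have "3 * real_of_ereal (1 / p) \<le> 1 + 1 * real_of_ereal (1 / q)"
  proof (rule estimate_holds_strips[OF est, where \<delta> = "1 / 4" and A = "real d - 1"
        and B = "24 * (real d)\<^sup>2"
        and l = "\<lambda>_. 5 / 4" and u = "\<lambda>_. 7 / 4" and g = "\<lambda>z. z" and w = "\<lambda>x. (real d - 1) * x"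
        and l' = "\<lambda>x. - 3 * x" and u' = "\<lambda>x. 3 * x" and g' = "\<lambda>z. real d * z"
        and w' = "\<lambda>x. 2 * (real d)\<^sup>2 * x\<^sup>2" and a = "\<lambda>x. 1 - x" and b = "\<lambda>_. 1"], goal_cases)
    case (10 x y1 y2)
    \<comment> \<open>Decomposes y = t (1, 1) + s (1, d) with t = y1 - s: subtracting the endpoint
      of the t-dilate leaves a point on the line of slope d through the origin. As |s| <= x < 1/4,
      the range [5/4, 7/4] of \<open>y1\<close> keeps t in [1, 2].\<close>
    define s where "s = (y2 - y1) / (real d - 1)"
    have y2: "y2 = y1 + (real d - 1) * s"
      using d by (simp add: s_def)
    have "\<bar>s\<bar> \<le> x"
      using 10 d by (simp add: s_def abs_divide field_simps)
    show ?case
    proof (intro bexI[of _ "y1 - s"] ballI)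
      show t: "y1 - s \<in> {1..2}"
        using 10 \<open>\<bar>s\<bar> \<le> x\<close> by auto
      fix v assume v: "v \<in> {1 - x..1}"
      have "(y1 - s) * (1 - v) \<le> 2 * x" "0 \<le> (y1 - s) * (1 - v)"
        using t v by (auto intro!: mult_mono)
      moreover have "y1 - (y1 - s) * v = s + (y1 - s) * (1 - v)"
        by (simp add: algebra_simps)
      ultimately have 1: "- 3 * x \<le> y1 - (y1 - s) * v" "y1 - (y1 - s) * v \<le> 3 * x"
        using \<open>\<bar>s\<bar> \<le> x\<close> by linarith+
      \<comment> \<open>The terms in \<open>s\<close> cancel because F follows the line of slope d;
        what remains is t times the second-order remainder.\<close>
      have "y2 - (y1 - s) * (v ^ d + 0) - real d * (y1 - (y1 - s) * v)
          = (y1 - s) * (1 - v ^ d - real d * (1 - v))"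
        by (simp add: y2 algebra_simps)
      also have "\<bar>\<dots>\<bar> \<le> 2 * ((real d)\<^sup>2 * x\<^sup>2)"
        unfolding abs_mult
      proof (rule mult_mono)
        have "\<bar>1 - v ^ d - real d * (1 - v)\<bar> \<le> (real d)\<^sup>2 * (1 - v)\<^sup>2"
          using 10 v by (intro one_minus_power_second_order) auto
        also have "\<dots> \<le> (real d)\<^sup>2 * x\<^sup>2"
          using v by (intro mult_left_mono power_mono) auto
        finally show "\<bar>1 - v ^ d - real d * (1 - v)\<bar> \<le> (real d)\<^sup>2 * x\<^sup>2" .
      qed (use t in auto)
      finally show "- 3 * x \<le> y1 - (y1 - s) * v \<and> y1 - (y1 - s) * v \<le> 3 * x \<and>
          \<bar>y2 - (y1 - s) * (v ^ d + 0) - real d * (y1 - (y1 - s) * v)\<bar> \<le> 2 * (real d)\<^sup>2 * x\<^sup>2"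
        using 1 by simp
    qed
  qed (use d in \<open>auto simp: powr_numeral power2_eq_square power3_eq_cube intro!: continuous_intros\<close>)
  then show ?thesis
    by simp
qed

text \<open>The heights in E run between c and 2c, the heights of the flat points (0, t c). Choosing
  t according to y moves the flat arc into the same small box for every y, so E keeps an area of
  order x against x^(d + 1) for F.\<close>

lemma necessary_C5:
  assumes est: "estimate_holds d c p q" "1 \<le> p" "1 \<le> q" and c: "c \<noteq> 0"
  shows "(real d + 1) * real_of_ereal (1 / p) - 1 \<le> real_of_ereal (1 / q)"
proof -
  have "(real d + 1) * real_of_ereal (1 / p) \<le> 1 + 1 * real_of_ereal (1 / q)"
  proof (rule estimate_holds_strips[OF est, where \<delta> = 1 and A = "2 * \<bar>c\<bar>" and B = 24
        and l = "\<lambda>x. - x" and u = "\<lambda>x. x" and g = "\<lambda>_. 3 * c / 2" and w = "\<lambda>_. \<bar>c\<bar> / 2"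
        and l' = "\<lambda>x. - 3 * x" and u' = "\<lambda>x. 3 * x" and g' = "\<lambda>_. 0"
        and w' = "\<lambda>x. 2 * x ^ d" and a = "\<lambda>_. 0" and b = "\<lambda>x. x"], goal_cases)
    case (10 x y1 y2)
    show ?case
    \<comment> \<open>With t c = y2 the vertical shift cancels and the second coordinate becomes -t
      v^d; this works for either sign of c.\<close>
    proof (intro bexI[of _ "y2 / c"] ballI)
      have "y2 / c - 3 / 2 = (y2 - 3 * c / 2) / c"
        using c by (simp add: field_simps)
      then have "\<bar>y2 / c - 3 / 2\<bar> = \<bar>y2 - 3 * c / 2\<bar> / \<bar>c\<bar>"
        by (simp only: abs_divide)
      also have "\<dots> \<le> 1 / 2"
        using 10 c by (simp add: field_simps)
      finally have t: "1 \<le> y2 / c" "y2 / c \<le> 2"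
        by linarith+
      then show "y2 / c \<in> {1..2}"
        by simp
      fix v assume v: "v \<in> {0..x}"
      have "0 \<le> y2 / c * v" "y2 / c * v \<le> 2 * x" "0 \<le> y2 / c * v ^ d" "y2 / c * v ^ d \<le> 2 * x ^ d"
        using t v by (auto intro!: mult_mono mult_nonneg_nonneg power_mono simp del: times_divide_eq_left)
      moreover have "y2 - y2 / c * (v ^ d + c) - 0 = - (y2 / c * v ^ d)"
        using c by (simp add: field_simps)
      ultimately show "- 3 * x \<le> y1 - y2 / c * v \<and> y1 - y2 / c * v \<le> 3 * x \<and>
          \<bar>y2 - y2 / c * (v ^ d + c) - 0\<bar> \<le> 2 * x ^ d"
        using 10 by linarith
    qed
  qed (use c in \<open>auto simp: powr_add powr_realpow\<close>)
  then show ?thesis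
    by simp
qed

theorem theorem3p7:
  fixes d :: nat and c :: real and p q :: ereal
  assumes "d \<ge> 2" and "1 \<le> p" and "1 \<le> q"
    and "estimate_holds d c p q"
  shows "(c = 0 \<longrightarrow>
      1 / q \<le> 1 / p \<and>
      1 / q \<ge> 1 / (2 * p) \<and>
      ereal (real d + 1) / p - ereal (real d + 1) / q - 1 \<le> 0 \<and>
      1 / q \<ge> 3 / p - 1) \<and>
    (c \<noteq> 0 \<longrightarrow>
      1 / q \<le> 1 / p \<and>
      1 / q \<ge> 1 / (2 * p) \<and>
      1 / q \<ge> ereal (real d + 1) / p - 1)"
proof -
  \<comment> \<open>All conditions are linear in 1/p and 1/q, which are finite since p and q are at
    least 1; the extended-real claims thus become claims on \<open>a\<close> and
    \<open>b\<close>.\<close>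
  define a b where "a = real_of_ereal (1 / p)" and "b = real_of_ereal (1 / q)"
  have p: "ereal s / p = ereal (s * a)" and q: "ereal s / q = ereal (s * b)" for s
    unfolding a_def b_def using assms(2,3) by (simp_all only: ereal_divide_eq_recip)
  have p1: "1 / p = ereal a" and q1: "1 / q = ereal b" and p3: "3 / p = ereal (3 * a)"
    using p[of 1] q[of 1] p[of 3] by (simp_all only: one_ereal_def numeral_eq_ereal mult_1)
  have p2: "1 / (2 * p) = ereal (a / 2)"
    unfolding a_def using \<open>1 \<le> p\<close>
    by (cases rule: ereal_ge_1_cases) (auto simp: one_ereal_def field_simps)
  have "b \<le> a" "a / 2 \<le> b"
    using necessary_C1[OF assms(4,2,3)] necessary_C2[OF assms(4,2,3)] by (simp_all add: a_def b_def)
  moreover have "(real d + 1) * a - (real d + 1) * b - 1 \<le> 0" "3 * a - 1 \<le> b" if "c = 0"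
    using necessary_C3[of d p q] necessary_C4[of d p q] assms that by (simp_all add: a_def b_def)
  moreover have "(real d + 1) * a - 1 \<le> b" if "c \<noteq> 0"
    using necessary_C5[OF assms(4,2,3) that] by (simp add: a_def b_def)
  ultimately show ?thesis
    unfolding p q p1 q1 p2 p3 by (simp add: one_ereal_def zero_ereal_def)
qed

end
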